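(* Let $(X,\tau,T_1,T_2)$ be a bi-operator topological space and $(Y,\sigma)$ a topological space. If $f:(X,\tau,T_1,T_2)\to(Y,\sigma)$ is a contra-$\mathcal{B}$-continuous surjective function and $X$ is $\mathcal{B}$-compact, then $Y$ is contra-compact.
   Context: An operator associated with a topology $\tau$ on $X$ is a function $T:P(X)\to P(X)$ ($P(X)$ the power set of $X$) such that $U\subseteq T(U)$ for all $U\in\tau$. A bi-operator topological space $(X,\tau,T_1,T_2)$ is a topological space $(X,\tau)$ with two operators $T_1,T_2$ associated with $\tau$. A subset $S\subseteq X$ is $\mathcal{B}$-open if $S\subseteq T_1(S)\cup T_2(S)$, and $\mathcal{B}$-closed if its complement is $\mathcal{B}$-open. A function $f:(X,\tau,T_1,T_2)\to(Y,\sigma)$ is contra-$\mathcal{B}$-continuous if $f^{-1}(V)$ is $\mathcal{B}$-closed in $X$ for each open subset $V$ of $Y$. $X$ is $\mathcal{B}$-compact if every cover of $X$ by $\mathcal{B}$-open sets has a finite subcover. A topological space is contra-compact if every cover of it by closed sets has a finite subcover. *)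

theory Defs
  imports "HOL-Analysis.Abstract_Topology"
begin

text \<open>
  The underlying set of a space is \<^term>\<open>topspace X\<close>. A map from the power set of \<^term>\<open>topspace X\<close>
  to itself is a total function on \<^typ>\<open>'a set\<close> that preserves subsets of \<^term>\<open>topspace X\<close>; its
  values elsewhere are unconstrained, and no definition below depends on them.
\<close>

definition operator_on :: "'a topology \<Rightarrow> ('a set \<Rightarrow> 'a set) \<Rightarrow> bool" where
  "operator_on X T \<longleftrightarrow>
     T \<in> Pow (topspace X) \<rightarrow> Pow (topspace X) \<and> (\<forall>U. openin X U \<longrightarrow> U \<subseteq> T U)"

definition bi_operator_space ::
    "'a topology \<Rightarrow> ('a set \<Rightarrow> 'a set) \<Rightarrow> ('a set \<Rightarrow> 'a set) \<Rightarrow> bool" where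
  "bi_operator_space X T1 T2 \<longleftrightarrow> operator_on X T1 \<and> operator_on X T2"

definition B_open ::
    "'a topology \<Rightarrow> ('a set \<Rightarrow> 'a set) \<Rightarrow> ('a set \<Rightarrow> 'a set) \<Rightarrow> 'a set \<Rightarrow> bool" where
  "B_open X T1 T2 S \<longleftrightarrow> S \<subseteq> topspace X \<and> S \<subseteq> T1 S \<union> T2 S"

definition B_closed ::
    "'a topology \<Rightarrow> ('a set \<Rightarrow> 'a set) \<Rightarrow> ('a set \<Rightarrow> 'a set) \<Rightarrow> 'a set \<Rightarrow> bool" where
  "B_closed X T1 T2 S \<longleftrightarrow> S \<subseteq> topspace X \<and> B_open X T1 T2 (topspace X - S)"

definition contra_B_continuous_map ::
    "'a topology \<Rightarrow> ('a set \<Rightarrow> 'a set) \<Rightarrow> ('a set \<Rightarrow> 'a set) \<Rightarrow> 'b topology \<Rightarrow> ('a \<Rightarrow> 'b) \<Rightarrow> bool" where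
  "contra_B_continuous_map X T1 T2 Y f \<longleftrightarrow>
     f \<in> topspace X \<rightarrow> topspace Y \<and>
     (\<forall>V. openin Y V \<longrightarrow> B_closed X T1 T2 {x \<in> topspace X. f x \<in> V})"

definition B_compact_space ::
    "'a topology \<Rightarrow> ('a set \<Rightarrow> 'a set) \<Rightarrow> ('a set \<Rightarrow> 'a set) \<Rightarrow> bool" where
  "B_compact_space X T1 T2 \<longleftrightarrow>
     (\<forall>\<U>. (\<forall>U\<in>\<U>. B_open X T1 T2 U) \<and> \<Union>\<U> = topspace X \<longrightarrow>
        (\<exists>\<F>. finite \<F> \<and> \<F> \<subseteq> \<U> \<and> \<Union>\<F> = topspace X))"

definition contra_compact_space :: "'b topology \<Rightarrow> bool" where
  "contra_compact_space Y \<longleftrightarrow>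
     (\<forall>\<C>. (\<forall>C\<in>\<C>. closedin Y C) \<and> \<Union>\<C> = topspace Y \<longrightarrow>
        (\<exists>\<F>. finite \<F> \<and> \<F> \<subseteq> \<C> \<and> \<Union>\<F> = topspace Y))"

end

theory Submission
  imports Defs
begin

text \<open>
  Contra-continuity turns the closed sets of the codomain into \<open>\<B>\<close>-open sets of the domain, since
  preimages commute with complements. A closed cover of \<open>Y\<close> therefore pulls back to a \<open>\<B>\<close>-open
  cover of \<open>X\<close>; the members of \<open>Y\<close>'s cover whose preimages form a finite subcover of \<open>X\<close>
  cover \<open>Y\<close>, because a surjection carries the preimage of a set back onto that set.
\<close>

lemma contra_B_continuous_map_B_open_preimage:
  assumes "contra_B_continuous_map X T1 T2 Y f" and "closedin Y C"
  shows "B_open X T1 T2 {x \<in> topspace X. f x \<in> C}"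
proof -
  have "openin Y (topspace Y - C)"
    using assms(2) by blast
  then have "B_open X T1 T2 (topspace X - {x \<in> topspace X. f x \<in> topspace Y - C})"
    using assms(1) unfolding contra_B_continuous_map_def B_closed_def by blast
  moreover have "topspace X - {x \<in> topspace X. f x \<in> topspace Y - C} = {x \<in> topspace X. f x \<in> C}"
    using assms(1) unfolding contra_B_continuous_map_def by blast
  ultimately show ?thesis by simp
qed

theorem corollary31:
  fixes X :: "'a topology" and T1 T2 :: "'a set \<Rightarrow> 'a set"
    and Y :: "'b topology" and f :: "'a \<Rightarrow> 'b"
  assumes "bi_operator_space X T1 T2"
    and "contra_B_continuous_map X T1 T2 Y f"
    and "f ` topspace X = topspace Y"
    and "B_compact_space X T1 T2"
  shows "contra_compact_space Y"
  unfolding contra_compact_space_def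
proof (intro allI impI, elim conjE)
  fix \<C>
  assume closed: "\<forall>C\<in>\<C>. closedin Y C" and cover: "\<Union>\<C> = topspace Y"
  define pre where "pre C = {x \<in> topspace X. f x \<in> C}" for C
  have "\<forall>U\<in>pre ` \<C>. B_open X T1 T2 U"
    using contra_B_continuous_map_B_open_preimage[OF assms(2)] closed
    unfolding pre_def by blast
  moreover have "\<Union>(pre ` \<C>) = topspace X"
    using assms(3) cover unfolding pre_def by blast
  ultimately obtain \<G> where "finite \<G>" "\<G> \<subseteq> pre ` \<C>" and \<G>: "\<Union>\<G> = topspace X"
    using assms(4) unfolding B_compact_space_def by meson
  then obtain \<F> where \<F>: "\<F> \<subseteq> \<C>" "finite \<F>" "\<G> = pre ` \<F>"
    by (meson finite_subset_image)
  have "topspace Y \<subseteq> \<Union>\<F>"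
  proof
    fix y
    assume "y \<in> topspace Y"
    then obtain x where "x \<in> topspace X" "y = f x"
      using assms(3) by blast
    then show "y \<in> \<Union>\<F>"
      using \<G> \<F>(3) unfolding pre_def by blast
  qed
  moreover have "\<Union>\<F> \<subseteq> topspace Y"
    using \<F>(1) cover by blast
  ultimately show "\<exists>\<F>. finite \<F> \<and> \<F> \<subseteq> \<C> \<and> \<Union>\<F> = topspace Y"
    using \<F> by blast
qed

end
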